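(* Let $s\in\mathbb{N}\cup\{\infty\}$, let $H\in\Gamma^s_1$, and let $T\in\Gamma^s_1$ transform $(\mathrm{AJ}_s(H))$ to $(\mathrm{AJ}_s(\widetilde H))$, where $\widetilde H=L_1$ (i.e. $\widetilde H(x)=x$). Then: (i) $\mathcal{A}_T(\mathcal{S}(\mathrm{AJ}_s(H)))=\mathcal{S}(\mathrm{AJ}_s(L_1))=\mathcal{L}$, and $\mathcal{L}$ is isomorphic to $(\boldsymbol{k}^\star,\cdot)$; (ii) $\mathcal{S}(\mathrm{AJ}_s(H))=\mathcal{A}_{T^{-1}}(\mathcal{L})=\{T\circ L_c\circ T^{-1}: c\in\boldsymbol{k}^\star\}$, and this group is isomorphic to $(\boldsymbol{k}^\star,\cdot)$.
   Context: $\boldsymbol{k}$ is a field of characteristic $0$, $\boldsymbol{k}^\star=\boldsymbol{k}\setminus\{0\}$. $\boldsymbol{k}[[x]]_\infty:=\boldsymbol{k}[[x]]$; for $s\in\mathbb{N}$, $\boldsymbol{k}[[x]]_s=\boldsymbol{k}[[x]]/(x^{s+1})$, with elements identified with polynomials $\sum_{j=0}^s c_jx^j$ and operations (including substitution) computed modulo $x^{s+1}$. $\Gamma^s$ is the group (under substitution $\circ$, identity $x$) of $f\in\boldsymbol{k}[[x]]_s$ of order exactly $1$, and $\Gamma^s_1=\{f\in\Gamma^s: f(x)\equiv x \bmod x^2\}$. Inverses $T^{-1}$ are with respect to substitution. $L_c(x)=cx$ and $\mathcal{L}=\{L_c:c\in\boldsymbol{k}^\star\}\subset\Gamma^s$.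 For $H\in\boldsymbol{k}[[x]]_s$ of order $\ge1$, $(\mathrm{AJ}_s(H))$ is the equation $(H\circ\Phi)(x)=\frac{d\Phi}{dx}\cdot H(x)$ (mod $x^{s+1}$ if $s<\infty$), and $\mathcal{S}(\mathrm{AJ}_s(H))$ is the set of its solutions $\Phi\in\Gamma^s$, a group under substitution. We say that $T\in\Gamma^s_1$ transforms $(\mathrm{AJ}_s(H))$ to $(\mathrm{AJ}_s(\widetilde H))$ if $\widetilde H(x)=\left(\frac{dT}{dx}\right)^{-1}(H\circ T)(x)$ (multiplicative inverse of $dT/dx$; mod $x^{s+1}$ if $s<\infty$), i.e. $(H\circ T)(x)=\frac{dT}{dx}\widetilde H(x)$. $\mathcal{A}_T:\Gamma^s\to\Gamma^s$ is the inner automorphism $\mathcal{A}_T(F)=T^{-1}\circ F\circ T$. *)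

theory Defs
  imports
    "HOL-Computational_Algebra.Formal_Power_Series"
    "HOL-Library.Extended_Nat"
    "HOL-Algebra.Group"
begin

(* Reduction modulo x^(s+1); no reduction for s = \<infinity>.  The elements of k[[x]]_s are
   represented by the power series f with trunc_fps s f = f, i.e. for finite s by the
   polynomials of degree at most s. *)
definition trunc_fps :: "enat \<Rightarrow> 'a::zero fps \<Rightarrow> 'a fps" where
  "trunc_fps s f = (case s of enat m \<Rightarrow> fps_cutoff (Suc m) f | \<infinity> \<Rightarrow> f)"

definition fps_mod :: "enat \<Rightarrow> 'a::zero fps set" where
  "fps_mod s = {f. trunc_fps s f = f}"

definition Gam :: "enat \<Rightarrow> 'a::field_char_0 fps monoid" where
  "Gam s = \<lparr>carrier = {f \<in> fps_mod s. subdegree f = 1},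
            monoid.mult = (\<lambda>f g. trunc_fps s (f oo g)),
            one = fps_X\<rparr>"

definition Gam1 :: "enat \<Rightarrow> 'a::field_char_0 fps set" where
  "Gam1 s = {f \<in> carrier (Gam s). fps_cutoff 2 f = fps_cutoff 2 fps_X}"

definition dil :: "'a::field_char_0 \<Rightarrow> 'a fps" where
  "dil c = fps_const c * fps_X"

definition Dil :: "'a::field_char_0 fps set" where
  "Dil = {dil c |c. c \<noteq> 0}"

definition kstar :: "'a::field_char_0 monoid" where
  "kstar = \<lparr>carrier = UNIV - {0}, monoid.mult = (*), one = 1\<rparr>"

(* For finite s the derivative is that of the polynomial representative; another
   representative changes it by multiples of x^s only, which is harmless because the
   derivative is multiplied by the series H, of order at least 1. *)
definition AJ :: "enat \<Rightarrow> 'a::field_char_0 fps \<Rightarrow> 'a fps \<Rightarrow> bool" where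
  "AJ s H \<Phi> \<longleftrightarrow> trunc_fps s (H oo \<Phi>) = trunc_fps s (fps_deriv \<Phi> * H)"

definition AJ_sols :: "enat \<Rightarrow> 'a::field_char_0 fps \<Rightarrow> 'a fps set" where
  "AJ_sols s H = {\<Phi> \<in> carrier (Gam s). AJ s H \<Phi>}"

definition transforms_AJ :: "enat \<Rightarrow> 'a::field_char_0 fps \<Rightarrow> 'a fps \<Rightarrow> 'a fps \<Rightarrow> bool" where
  "transforms_AJ s T H H' \<longleftrightarrow> T \<in> Gam1 s \<and> H' = trunc_fps s (inverse (fps_deriv T) * (H oo T))"

definition inner_aut :: "enat \<Rightarrow> 'a::field_char_0 fps \<Rightarrow> 'a fps \<Rightarrow> 'a fps" where
  "inner_aut s T F = inv\<^bsub>Gam s\<^esub> T \<otimes>\<^bsub>Gam s\<^esub> F \<otimes>\<^bsub>Gam s\<^esub> T"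

lemma trunc_fps_nth: "fps_nth (trunc_fps s f) n = (if enat n \<le> s then fps_nth f n else 0)"
  by (cases s) (auto simp: trunc_fps_def)

lemma trunc_fps_eq_iff:
  "trunc_fps s f = trunc_fps s g \<longleftrightarrow> (\<forall>n. enat n \<le> s \<longrightarrow> fps_nth f n = fps_nth g n)"
  by (auto simp: fps_eq_iff trunc_fps_nth)

lemma trunc_fps_idem [simp]: "trunc_fps s (trunc_fps s f) = trunc_fps s f"
  by (simp add: fps_eq_iff trunc_fps_nth)

lemma trunc_fps_mult_cong:
  fixes f g :: "'a::comm_ring_1 fps"
  assumes "trunc_fps s f = trunc_fps s f'" "trunc_fps s g = trunc_fps s g'"
  shows "trunc_fps s (f * g) = trunc_fps s (f' * g')"
proof -
  have "fps_nth (f * g) n = fps_nth (f' * g') n" if "enat n \<le> s" for n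
  proof -
    have "enat i \<le> s" if "i \<le> n" for i
      using \<open>enat n \<le> s\<close> that by (meson enat_ord_simps(1) order_trans)
    then show ?thesis
      using assms by (auto simp: fps_mult_nth trunc_fps_eq_iff intro!: sum.cong)
  qed
  then show ?thesis by (simp add: trunc_fps_eq_iff)
qed

lemma trunc_fps_compose_cong:
  fixes f g :: "'a::comm_ring_1 fps"
  assumes "trunc_fps s f = trunc_fps s f'" "trunc_fps s g = trunc_fps s g'"
  shows "trunc_fps s (f oo g) = trunc_fps s (f' oo g')"
proof -
  have p: "trunc_fps s (g ^ i) = trunc_fps s (g' ^ i)" for i
    by (induction i) (auto intro: trunc_fps_mult_cong assms(2))
  have "fps_nth (f oo g) n = fps_nth (f' oo g') n" if "enat n \<le> s" for n
  proof -
    have "enat i \<le> s" if "i \<le> n" for i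
      using \<open>enat n \<le> s\<close> that by (meson enat_ord_simps(1) order_trans)
    then show ?thesis
      using assms(1) p \<open>enat n \<le> s\<close>
      by (auto simp: fps_compose_nth trunc_fps_eq_iff intro!: sum.cong)
  qed
  then show ?thesis by (simp add: trunc_fps_eq_iff)
qed

lemma Gam_carrier_iff:
  "f \<in> carrier (Gam s) \<longleftrightarrow> trunc_fps s f = f \<and> fps_nth f 0 = 0 \<and> fps_nth f 1 \<noteq> 0"
proof -
  have "subdegree f = 1 \<longleftrightarrow> fps_nth f 0 = 0 \<and> fps_nth f 1 \<noteq> 0"
    by (metis less_one nth_less_subdegree_zero nth_subdegree_nonzero subdegreeI subdegree_0 zero_neq_one)
  then show ?thesis by (auto simp: Gam_def fps_mod_def)
qed

lemma Gam_mult: "f \<otimes>\<^bsub>Gam s\<^esub> g = trunc_fps s (f oo g)"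
  by (simp add: Gam_def)

lemma Gam_one: "\<one>\<^bsub>Gam s\<^esub> = fps_X"
  by (simp add: Gam_def)

lemma Gam_empty: "carrier (Gam 0 :: 'a::field_char_0 fps monoid) = {}"
  by (auto simp: Gam_carrier_iff fps_eq_iff trunc_fps_nth zero_enat_def split: if_splits)

lemma one_le_of_Gam:
  assumes "f \<in> carrier (Gam s)" shows "enat 1 \<le> s"
  using assms by (metis Gam_carrier_iff trunc_fps_nth)

lemma Gam1_iff: "f \<in> Gam1 s \<longleftrightarrow> f \<in> carrier (Gam s) \<and> fps_nth f 1 = 1"
  by (auto simp: Gam1_def fps_cutoff_eq_fps_cutoff_iff Gam_carrier_iff less_2_cases_iff)

lemma Gam_closed:
  assumes "f \<in> carrier (Gam s)" "g \<in> carrier (Gam s)"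
  shows "trunc_fps s (f oo g) \<in> carrier (Gam s)"
  using assms one_le_of_Gam[OF assms(1)]
  by (auto simp: Gam_carrier_iff trunc_fps_nth fps_compose_nth)

(* Gam 0 has an empty carrier, hence the hypothesis. *)
lemma group_Gam:
  assumes "1 \<le> s"
  shows "group (Gam s :: 'a::field_char_0 fps monoid)"
proof (rule groupI)
  have s: "enat 0 \<le> s" "enat 1 \<le> s"
    using assms by (auto simp: one_enat_def zero_enat_def[symmetric])
  show one: "\<one>\<^bsub>Gam s\<^esub> \<in> carrier (Gam s :: 'a fps monoid)"
    using s by (auto simp: Gam_one Gam_carrier_iff fps_eq_iff trunc_fps_nth)
  fix f g h :: "'a fps"
  assume f: "f \<in> carrier (Gam s)"
  show "\<one>\<^bsub>Gam s\<^esub> \<otimes>\<^bsub>Gam s\<^esub> f = f"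
    using f by (simp add: Gam_one Gam_mult Gam_carrier_iff fps_X_fps_compose_startby0)
  show "\<exists>y\<in>carrier (Gam s). y \<otimes>\<^bsub>Gam s\<^esub> f = \<one>\<^bsub>Gam s\<^esub>"
  proof
    let ?y = "trunc_fps s (fps_inv f)"
    have f01: "fps_nth f 0 = 0" "fps_nth f 1 \<noteq> 0" using f by (auto simp: Gam_carrier_iff)
    have "trunc_fps s (?y oo f) = trunc_fps s (fps_inv f oo f)"
      by (rule trunc_fps_compose_cong) auto
    also have "\<dots> = fps_X"
      using fps_inv[OF f01] one by (simp add: Gam_carrier_iff Gam_one)
    finally show "?y \<otimes>\<^bsub>Gam s\<^esub> f = \<one>\<^bsub>Gam s\<^esub>" by (simp add: Gam_mult Gam_one)
    show "?y \<in> carrier (Gam s)"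
      using f01 s by (auto simp: Gam_carrier_iff trunc_fps_nth fps_inv_def)
  qed
  assume g: "g \<in> carrier (Gam s)"
  show "f \<otimes>\<^bsub>Gam s\<^esub> g \<in> carrier (Gam s)" by (simp add: Gam_mult Gam_closed f g)
  assume h: "h \<in> carrier (Gam s)"
  have "trunc_fps s (trunc_fps s (f oo g) oo h) = trunc_fps s ((f oo g) oo h)"
    by (rule trunc_fps_compose_cong) auto
  also have "\<dots> = trunc_fps s (f oo (g oo h))"
    using g h by (simp add: fps_compose_assoc Gam_carrier_iff)
  also have "\<dots> = trunc_fps s (f oo trunc_fps s (g oo h))"
    by (rule trunc_fps_compose_cong) auto
  finally show "f \<otimes>\<^bsub>Gam s\<^esub> g \<otimes>\<^bsub>Gam s\<^esub> h = f \<otimes>\<^bsub>Gam s\<^esub> (g \<otimes>\<^bsub>Gam s\<^esub> h)"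
    by (simp add: Gam_mult)
qed

end

theory Submission
  imports Defs
begin

text \<open>
  The equation \<open>H \<circ> \<Phi> = \<Phi>' \<cdot> H\<close> says that \<open>\<Phi>\<close> maps the formal vector field \<open>H d/dx\<close> to
  itself, and \<open>T\<close> transforms the equation of \<open>H\<close> to that of \<open>K\<close> when \<open>H \<circ> T = T' \<cdot> K\<close>, that is,
  when \<open>T\<close> maps \<open>K d/dx\<close> to \<open>H d/dx\<close>.  Both are instances of one ternary relation
  \<open>A \<circ> F = F' \<cdot> B\<close>, for which one writes \<open>F : B \<rightarrow> A\<close>.  By the chain rule such arrows compose and
  can be inverted, so they form a groupoid, and the solutions of the equation of \<open>H\<close> are the
  automorphisms of the object \<open>H\<close>.  Conjugation by an arrow \<open>T : K \<rightarrow> H\<close> is then an isomorphism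
  from the automorphism group of \<open>H\<close> onto that of \<open>K\<close>
  (\<open>inner_aut_iso_AJ_sols\<close>).

  This reduces everything to \<open>K = x\<close>.  There the equation is Euler's equation \<open>\<Phi> = x \<Phi>'\<close>:
  comparing coefficients gives \<open>\<Phi>\<^sub>n = n \<Phi>\<^sub>n\<close>, so in characteristic zero
  only the linear coefficient survives, and the solutions are the dilations
  (\<open>AJ_sols_dil_one\<close>), which compose by multiplying their factors.

  For finite \<open>s\<close> everything is read modulo \<open>x^(s+1)\<close>.  Differentiation loses one order
  of precision, which is regained because every derivative is multiplied by a vector
  field that vanishes at the origin (\<open>trunc_fps_deriv_mult_cong\<close>).
\<close>

lemma trunc_fps_deriv_mult_cong:
  fixes f g A B :: "'a::comm_ring_1 fps"
  assumes fg: "trunc_fps s f = trunc_fps s g" and AB: "trunc_fps s A = trunc_fps s B"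
    and A0: "fps_nth A 0 = 0"
  shows "trunc_fps s (fps_deriv f * A) = trunc_fps s (fps_deriv g * B)"
proof -
  have "fps_nth (fps_deriv f * A) n = fps_nth (fps_deriv g * A) n" if n: "enat n \<le> s" for n
  proof -
    have "fps_nth (fps_deriv f) i * fps_nth A (n - i) = fps_nth (fps_deriv g) i * fps_nth A (n - i)"
      if "i \<le> n" for i
      \<comment> \<open>The coefficient of the derivative that may lie beyond the precision, \<open>i = n = s\<close>, meets \<open>A\<^sub>0 = 0\<close>.\<close>
    proof (cases "i = n")
      case False
      with that have "enat (Suc i) \<le> enat n" by simp
      then have "enat (Suc i) \<le> s" using n by (rule order_trans)
      then show ?thesis using fg by (simp add: trunc_fps_eq_iff)
    qed (simp add: A0)
    then show ?thesis by (simp add: fps_mult_nth)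
  qed
  then have "trunc_fps s (fps_deriv f * A) = trunc_fps s (fps_deriv g * A)"
    by (simp add: trunc_fps_eq_iff)
  also have "\<dots> = trunc_fps s (fps_deriv g * B)"
    by (rule trunc_fps_mult_cong) (auto simp: AB)
  finally show ?thesis .
qed

section \<open>The groupoid of formal vector fields\<close>

text \<open>
  \<open>intertwines s F A B\<close> is the arrow \<open>F : B \<rightarrow> A\<close>: the substitution \<open>F\<close> maps the
  vector field \<open>B d/dx\<close> to \<open>A d/dx\<close>.
\<close>

definition intertwines :: "enat \<Rightarrow> 'a::field_char_0 fps \<Rightarrow> 'a fps \<Rightarrow> 'a fps \<Rightarrow> bool" where
  "intertwines s F A B \<longleftrightarrow> trunc_fps s (A oo F) = trunc_fps s (fps_deriv F * B)"

lemma AJ_sols_eq_intertwines: "AJ_sols s H = {\<Phi> \<in> carrier (Gam s). intertwines s \<Phi> H H}"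
  by (simp add: AJ_sols_def AJ_def intertwines_def)

lemma transforms_AJ_imp_intertwines:
  assumes "transforms_AJ s T H H'"
  shows "intertwines s T H H'"
proof -
  have H': "H' = trunc_fps s (inverse (fps_deriv T) * (H oo T))"
    and T1: "fps_nth T 1 = 1"
    using assms by (auto simp: transforms_AJ_def Gam1_iff)
  have "trunc_fps s (fps_deriv T * H') = trunc_fps s (fps_deriv T * (inverse (fps_deriv T) * (H oo T)))"
    by (rule trunc_fps_mult_cong) (auto simp: H')
  also have "fps_deriv T * (inverse (fps_deriv T) * (H oo T)) = H oo T"
    using T1 inverse_mult_eq_1'[of "fps_deriv T"] by (simp add: mult.assoc[symmetric])
  finally show ?thesis by (simp add: intertwines_def)
qed

lemma intertwines_one: "intertwines s \<one>\<^bsub>Gam s\<^esub> A A"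
  by (simp add: intertwines_def Gam_one)

text \<open>The chain rule makes arrows compose.\<close>

lemma intertwines_mult:
  assumes FAB: "intertwines s F A B" and GBC: "intertwines s G B C"
    and F0: "fps_nth F 0 = 0" and G0: "fps_nth G 0 = 0" and C0: "fps_nth C 0 = 0"
  shows "intertwines s (F \<otimes>\<^bsub>Gam s\<^esub> G) A C"
proof -
  have "trunc_fps s (A oo trunc_fps s (F oo G)) = trunc_fps s (A oo (F oo G))"
    by (rule trunc_fps_compose_cong) auto
  also have "A oo (F oo G) = (A oo F) oo G"
    by (rule fps_compose_assoc[OF G0 F0])
  also have "trunc_fps s \<dots> = trunc_fps s ((fps_deriv F * B) oo G)"
    by (rule trunc_fps_compose_cong) (use FAB in \<open>auto simp: intertwines_def\<close>)
  also have "(fps_deriv F * B) oo G = (fps_deriv F oo G) * (B oo G)"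
    by (rule fps_compose_mult_distrib[OF G0])
  also have "trunc_fps s \<dots> = trunc_fps s ((fps_deriv F oo G) * (fps_deriv G * C))"
    by (rule trunc_fps_mult_cong) (use GBC in \<open>auto simp: intertwines_def\<close>)
  also have "(fps_deriv F oo G) * (fps_deriv G * C) = fps_deriv (F oo G) * C"
    using G0 by (simp add: fps_compose_deriv mult.assoc)
  also have "trunc_fps s \<dots> = trunc_fps s (fps_deriv (trunc_fps s (F oo G)) * C)"
    by (rule trunc_fps_deriv_mult_cong) (auto simp: C0)
  finally show ?thesis by (simp add: intertwines_def Gam_mult)
qed

text \<open>
  Substituting \<open>T\<^sup>-\<^sup>1\<close> into \<open>A \<circ> T = T' \<cdot> B\<close> and multiplying by the derivative of \<open>T\<^sup>-\<^sup>1\<close>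
  reverses the arrow, because \<open>(T\<^sup>-\<^sup>1)' \<cdot> (T' \<circ> T\<^sup>-\<^sup>1)\<close> is the derivative of \<open>T \<circ> T\<^sup>-\<^sup>1 = x\<close>.
\<close>

lemma intertwines_inv:
  assumes s: "1 \<le> s" and T: "T \<in> carrier (Gam s)" and TAB: "intertwines s T A B"
    and B0: "fps_nth B 0 = 0"
  shows "intertwines s (inv\<^bsub>Gam s\<^esub> T) B A"
proof -
  interpret group "Gam s :: 'a fps monoid" by (rule group_Gam[OF s])
  define U where "U = inv\<^bsub>Gam s\<^esub> T"
  have U0: "fps_nth U 0 = 0" and T0: "fps_nth T 0 = 0"
    using T inv_closed[OF T] by (auto simp: U_def Gam_carrier_iff)
  have TU: "trunc_fps s (T oo U) = fps_X" and X: "trunc_fps s (fps_X :: 'a fps) = fps_X"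
    using r_inv[OF T] one_closed by (auto simp: U_def Gam_mult Gam_one Gam_carrier_iff)
  have "trunc_fps s A = trunc_fps s (A oo (T oo U))"
    using trunc_fps_compose_cong[of s A A fps_X "T oo U"] TU X by simp
  also have "A oo (T oo U) = (A oo T) oo U"
    using U0 T0 by (simp add: fps_compose_assoc)
  also have "trunc_fps s \<dots> = trunc_fps s ((fps_deriv T * B) oo U)"
    by (rule trunc_fps_compose_cong) (use TAB in \<open>auto simp: intertwines_def\<close>)
  also have "(fps_deriv T * B) oo U = (fps_deriv T oo U) * (B oo U)"
    by (rule fps_compose_mult_distrib[OF U0])
  finally have "trunc_fps s (fps_deriv U * A)
      = trunc_fps s (fps_deriv U * ((fps_deriv T oo U) * (B oo U)))"
    by (intro trunc_fps_mult_cong) auto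
  also have "fps_deriv U * ((fps_deriv T oo U) * (B oo U)) = fps_deriv (T oo U) * (B oo U)"
    using U0 by (simp add: fps_compose_deriv mult_ac)
  also have "trunc_fps s \<dots> = trunc_fps s (fps_deriv fps_X * (B oo U))"
    by (rule trunc_fps_deriv_mult_cong) (auto simp: TU X B0)
  finally show ?thesis by (simp add: intertwines_def U_def)
qed

section \<open>Solution groups and their conjugation\<close>

lemma subgroup_AJ_sols:
  fixes H :: "'a::field_char_0 fps"
  assumes s: "1 \<le> s" and H0: "fps_nth H 0 = 0"
  shows "subgroup (AJ_sols s H) (Gam s)"
proof -
  interpret group "Gam s :: 'a fps monoid" by (rule group_Gam[OF s])
  show ?thesis
  proof (rule subgroupI)
    show "AJ_sols s H \<noteq> {}"
      using intertwines_one[of s H] one_closed by (auto simp: AJ_sols_eq_intertwines)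
  next
    fix F assume F: "F \<in> AJ_sols s H"
    show "inv\<^bsub>Gam s\<^esub> F \<in> AJ_sols s H"
      using F intertwines_inv[OF s _ _ H0] by (auto simp: AJ_sols_eq_intertwines)
    fix G assume G: "G \<in> AJ_sols s H"
    show "F \<otimes>\<^bsub>Gam s\<^esub> G \<in> AJ_sols s H"
      using F G intertwines_mult[OF _ _ _ _ H0]
      by (auto simp: AJ_sols_eq_intertwines) (auto simp: Gam_carrier_iff)
  qed (auto simp: AJ_sols_eq_intertwines)
qed

text \<open>Conjugating a loop at \<open>A\<close> by an arrow \<open>T : B \<rightarrow> A\<close> gives a loop at \<open>B\<close>.\<close>

lemma inner_aut_in_AJ_sols:
  assumes s: "1 \<le> s" and T: "T \<in> carrier (Gam s)" and TAB: "intertwines s T A B"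
    and A0: "fps_nth A 0 = 0" and B0: "fps_nth B 0 = 0" and F: "F \<in> AJ_sols s A"
  shows "inner_aut s T F \<in> AJ_sols s B"
proof -
  interpret group "Gam s :: 'a fps monoid" by (rule group_Gam[OF s])
  let ?U = "inv\<^bsub>Gam s\<^esub> T"
  have Fc: "F \<in> carrier (Gam s)" and FA: "intertwines s F A A"
    using F by (auto simp: AJ_sols_eq_intertwines)
  have zero: "fps_nth G 0 = 0" if "G \<in> carrier (Gam s)" for G :: "'a fps"
    using that by (simp add: Gam_carrier_iff)
  have "intertwines s (?U \<otimes>\<^bsub>Gam s\<^esub> F) B A"
    by (rule intertwines_mult[OF intertwines_inv[OF s T TAB B0] FA])
      (use zero Fc T A0 in auto)
  then have "intertwines s (?U \<otimes>\<^bsub>Gam s\<^esub> F \<otimes>\<^bsub>Gam s\<^esub> T) B B"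
    by (rule intertwines_mult[OF _ TAB]) (use zero Fc T B0 in auto)
  then show ?thesis using Fc T by (simp add: AJ_sols_eq_intertwines inner_aut_def)
qed

lemma inner_aut_inv_inner_aut:
  fixes T F :: "'a::field_char_0 fps"
  assumes s: "1 \<le> s" and T: "T \<in> carrier (Gam s)" and F: "F \<in> carrier (Gam s)"
  shows "inner_aut s (inv\<^bsub>Gam s\<^esub> T) (inner_aut s T F) = F"
proof -
  interpret group "Gam s :: 'a fps monoid" by (rule group_Gam[OF s])
  show ?thesis
    using T F by (simp add: inner_aut_def m_assoc) (simp add: m_assoc[symmetric])
qed

lemma inner_aut_mult:
  fixes T F G :: "'a::field_char_0 fps"
  assumes s: "1 \<le> s" and T: "T \<in> carrier (Gam s)"
    and F: "F \<in> carrier (Gam s)" and G: "G \<in> carrier (Gam s)"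
  shows "inner_aut s T (F \<otimes>\<^bsub>Gam s\<^esub> G) = inner_aut s T F \<otimes>\<^bsub>Gam s\<^esub> inner_aut s T G"
proof -
  interpret group "Gam s :: 'a fps monoid" by (rule group_Gam[OF s])
  have "T \<otimes>\<^bsub>Gam s\<^esub> (inv\<^bsub>Gam s\<^esub> T \<otimes>\<^bsub>Gam s\<^esub> K) = K" if "K \<in> carrier (Gam s)" for K
    using T that by (simp add: m_assoc[symmetric])
  then show ?thesis using T F G by (simp add: inner_aut_def m_assoc)
qed

text \<open>
  Both an arrow and its inverse conjugate loops to loops, so conjugation is a bijection
  between the two solution groups.
\<close>

lemma inner_aut_iso_AJ_sols:
  fixes T A B :: "'a::field_char_0 fps"
  assumes s: "1 \<le> s" and T: "T \<in> carrier (Gam s)" and TAB: "intertwines s T A B"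
    and A0: "fps_nth A 0 = 0" and B0: "fps_nth B 0 = 0"
  shows "inner_aut s T \<in> iso ((Gam s)\<lparr>carrier := AJ_sols s A\<rparr>) ((Gam s)\<lparr>carrier := AJ_sols s B\<rparr>)"
    and "inner_aut s (inv\<^bsub>Gam s\<^esub> T) ` AJ_sols s B = AJ_sols s A"
proof -
  interpret group "Gam s :: 'a fps monoid" by (rule group_Gam[OF s])
  let ?U = "inv\<^bsub>Gam s\<^esub> T"
  have U: "?U \<in> carrier (Gam s)" and UBA: "intertwines s ?U B A"
    using T intertwines_inv[OF s T TAB B0] by auto
  have to: "inner_aut s T F \<in> AJ_sols s B" if "F \<in> AJ_sols s A" for F
    by (rule inner_aut_in_AJ_sols[OF s T TAB A0 B0 that])
  have fro: "inner_aut s ?U G \<in> AJ_sols s A" if "G \<in> AJ_sols s B" for G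
    by (rule inner_aut_in_AJ_sols[OF s U UBA B0 A0 that])
  have UT: "inner_aut s ?U (inner_aut s T F) = F" if "F \<in> carrier (Gam s)" for F
    by (rule inner_aut_inv_inner_aut[OF s T that])
  have TU: "inner_aut s T (inner_aut s ?U G) = G" if "G \<in> carrier (Gam s)" for G
    using inner_aut_inv_inner_aut[OF s U that] T by simp
  have sub: "F \<in> carrier (Gam s)" if "F \<in> AJ_sols s C" for F C :: "'a fps"
    using that by (simp add: AJ_sols_def)
  have "bij_betw (inner_aut s T) (AJ_sols s A) (AJ_sols s B)"
    by (rule bij_betwI[where g = "inner_aut s ?U"]) (use to fro UT TU sub in auto)
  then show "inner_aut s T \<in> iso ((Gam s)\<lparr>carrier := AJ_sols s A\<rparr>) ((Gam s)\<lparr>carrier := AJ_sols s B\<rparr>)"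
    using to inner_aut_mult[OF s T] sub by (auto simp: iso_def hom_def)
  show "inner_aut s ?U ` AJ_sols s B = AJ_sols s A"
  proof (intro equalityI subsetI)
    fix F assume "F \<in> AJ_sols s A"
    then show "F \<in> inner_aut s ?U ` AJ_sols s B" using to UT sub by (metis image_eqI)
  qed (use fro in auto)
qed

section \<open>Dilations\<close>

lemma dil_nth: "fps_nth (dil c) n = (if n = 1 then c else 0)"
  by (simp add: dil_def)

lemma dil_one: "dil 1 = fps_X"
  by (simp add: dil_def)

lemma dil_in_Gam:
  assumes "1 \<le> s" "c \<noteq> 0"
  shows "dil c \<in> carrier (Gam s)"
  using assms by (auto simp: Gam_carrier_iff dil_nth fps_eq_iff trunc_fps_nth one_enat_def)

text \<open>
  Here the equation is \<open>\<Phi> = x \<Phi>'\<close>, that is, \<open>(n - 1) \<Phi>\<^sub>n = 0\<close> for all \<open>n\<close> up to \<open>s\<close>.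
\<close>

lemma AJ_sols_dil_one:
  assumes s: "1 \<le> s"
  shows "AJ_sols s (dil 1) = (Dil :: 'a::field_char_0 fps set)"
proof -
  have AJ_iff: "AJ s (dil 1) \<Phi> \<longleftrightarrow> (\<forall>n. enat n \<le> s \<longrightarrow> fps_nth \<Phi> n = of_nat n * fps_nth \<Phi> n)"
    if "\<Phi> \<in> carrier (Gam s)" for \<Phi> :: "'a fps"
  proof -
    have "fps_nth (fps_deriv \<Phi> * fps_X) n = of_nat n * fps_nth \<Phi> n" for n
      by (cases n) auto
    moreover have "dil 1 oo \<Phi> = \<Phi>"
      using that by (simp add: dil_one Gam_carrier_iff fps_X_fps_compose_startby0)
    ultimately show ?thesis
      unfolding AJ_def trunc_fps_eq_iff by (simp only: dil_one)
  qed
  show ?thesis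
  proof (intro equalityI subsetI)
    fix \<Phi> :: "'a fps" assume "\<Phi> \<in> AJ_sols s (dil 1)"
    then have c: "\<Phi> \<in> carrier (Gam s)"
      and e: "\<And>n. enat n \<le> s \<Longrightarrow> fps_nth \<Phi> n = of_nat n * fps_nth \<Phi> n"
      using AJ_iff by (auto simp: AJ_sols_def)
    have "fps_nth \<Phi> n = 0" if "n \<noteq> 1" for n
    proof (cases "enat n \<le> s")
      case True
      then have "(of_nat n - 1) * fps_nth \<Phi> n = 0" using e[of n] by (simp add: algebra_simps)
      moreover have "(of_nat n :: 'a) \<noteq> 1" using that by (metis of_nat_1 of_nat_eq_iff)
      ultimately show ?thesis by simp
    next
      case False
      then show ?thesis using c by (metis Gam_carrier_iff trunc_fps_nth)
    qed
    then have "\<Phi> = dil (fps_nth \<Phi> 1)" by (auto simp: fps_eq_iff dil_nth)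
    then show "\<Phi> \<in> Dil" using c by (auto simp: Dil_def Gam_carrier_iff)
  next
    fix \<Phi> :: "'a fps" assume "\<Phi> \<in> Dil"
    then obtain c where "c \<noteq> 0" "\<Phi> = dil c" by (auto simp: Dil_def)
    then show "\<Phi> \<in> AJ_sols s (dil 1)"
      using dil_in_Gam[OF s] AJ_iff by (auto simp: AJ_sols_def dil_nth)
  qed
qed

lemma dil_mult:
  fixes c d :: "'a::field_char_0"
  assumes s: "1 \<le> s"
  shows "dil c \<otimes>\<^bsub>Gam s\<^esub> dil d = dil (c * d)"
proof -
  have "dil c oo dil d = dil (c * d)"
    by (simp add: dil_def fps_compose_mult_distrib mult.assoc)
  then show ?thesis
    using s by (auto simp: Gam_mult fps_eq_iff trunc_fps_nth dil_nth one_enat_def)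
qed

lemma Dil_iso_kstar:
  assumes s: "1 \<le> s"
  shows "(Gam s)\<lparr>carrier := (Dil :: 'a::field_char_0 fps set)\<rparr> \<cong> (kstar :: 'a monoid)"
proof -
  have "inj_on dil (UNIV - {0 :: 'a})"
    by (rule inj_onI) (auto simp: dil_nth fps_eq_iff split: if_splits)
  then have "dil \<in> iso (kstar :: 'a monoid) ((Gam s)\<lparr>carrier := Dil\<rparr>)"
    by (auto simp: iso_def hom_def kstar_def Dil_def bij_betw_def dil_mult[OF s])
  moreover have "group (kstar :: 'a monoid)"
    by (rule groupI) (auto simp: kstar_def intro!: bexI[of _ "inverse _"])
  ultimately show ?thesis
    using group.iso_sym is_isoI by blast
qed

section \<open>The solution group of an equation transformable to \<open>\<Phi> = x \<Phi>'\<close>\<close>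

theorem theorem1:
  fixes s :: enat and H T :: "'a::field_char_0 fps"
  assumes "H \<in> Gam1 s"
    and "T \<in> Gam1 s"
    and "transforms_AJ s T H (dil 1)"
  shows
    "(inner_aut s T ` AJ_sols s H = AJ_sols s (dil 1) \<and>
      AJ_sols s (dil 1) = (Dil :: 'a fps set) \<and>
      subgroup (Dil :: 'a fps set) (Gam s) \<and>
      (Gam s)\<lparr>carrier := (Dil :: 'a fps set)\<rparr> \<cong> (kstar :: 'a monoid)) \<and>
     (AJ_sols s H = inner_aut s (inv\<^bsub>Gam s\<^esub> T) ` Dil \<and>
      inner_aut s (inv\<^bsub>Gam s\<^esub> T) ` Dil =
        {T \<otimes>\<^bsub>Gam s\<^esub> dil c \<otimes>\<^bsub>Gam s\<^esub> inv\<^bsub>Gam s\<^esub> T |c. c \<noteq> 0} \<and>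
      subgroup (AJ_sols s H) (Gam s) \<and>
      (Gam s)\<lparr>carrier := AJ_sols s H\<rparr> \<cong> (kstar :: 'a monoid))"
proof -
  have Tc: "T \<in> carrier (Gam s)" and H0: "fps_nth H 0 = 0"
    using assms by (auto simp: Gam1_iff Gam_carrier_iff)
  have s: "1 \<le> s" using one_le_of_Gam[OF Tc] by (simp add: one_enat_def)
  interpret group "Gam s :: 'a fps monoid" by (rule group_Gam[OF s])
  have X0: "fps_nth (dil 1 :: 'a fps) 0 = 0" by (simp add: dil_nth)
  note D = AJ_sols_dil_one[OF s, where 'a = 'a]
  have arrow: "intertwines s T H (dil 1)"
    by (rule transforms_AJ_imp_intertwines[OF assms(3)])
  note conj = inner_aut_iso_AJ_sols[OF s Tc arrow H0 X0]
  have img: "inner_aut s T ` AJ_sols s H = AJ_sols s (dil 1)"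
    using conj(1) by (simp add: iso_def bij_betw_def)
  have subD: "subgroup (Dil :: 'a fps set) (Gam s)"
    using subgroup_AJ_sols[OF s X0] by (simp add: D)
  have isoH: "(Gam s)\<lparr>carrier := AJ_sols s H\<rparr> \<cong> (kstar :: 'a monoid)"
    using is_isoI[OF conj(1)] Dil_iso_kstar[OF s, where 'a = 'a] unfolding D by (rule iso_trans)
  have sols: "AJ_sols s H = inner_aut s (inv\<^bsub>Gam s\<^esub> T) ` Dil"
    using conj(2) D by simp
  have explicit: "inner_aut s (inv\<^bsub>Gam s\<^esub> T) ` Dil =
      {T \<otimes>\<^bsub>Gam s\<^esub> dil c \<otimes>\<^bsub>Gam s\<^esub> inv\<^bsub>Gam s\<^esub> T |c. c \<noteq> 0}"
    using Tc by (auto simp: inner_aut_def Dil_def)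
  from img D subD Dil_iso_kstar[OF s, where 'a = 'a] sols explicit
    subgroup_AJ_sols[OF s H0] isoH
  show ?thesis by blast
qed

end
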